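(* Let $L>0$ and let $\mathcal{I}=\{(x_i,f_i,\xi_i)\}_{i\in[N]}$ with $(x_i,f_i,\xi_i)\in\operatorname{ri}(\Delta_d)\times\mathbb{R}\times\Theta_d$. Put $$r_i:=f_i-\langle\xi_i,x_i\rangle,\qquad w_i:=\exp\big(L^{-1}(r_i\mathsf{1}_d+\xi_i)\big),\qquad W_{\mathcal I}:=\operatorname{conv}\{w_1,\dots,w_N\},$$ and assume that $\langle x_i,w_j/w_i\rangle\le1$ for all $i,j\in[N]$. Then the function $f_{\mathcal I}:\Delta_d\to\mathbb{R}$ defined by $$f_{\mathcal I}(x):=L\max_{w\in W_{\mathcal I}}\langle x,\log w\rangle$$ belongs to $\mathsf{Ent}_d(L)$, interpolates $\mathcal{I}$ (that is, $f_{\mathcal I}(x_i)=f_i$ and $\nabla f_{\mathcal I}(x_i)=\xi_i$ for all $i\in[N]$), and is pointwise minimal on $\Delta_d$ among all functions with these properties: every $F\in\mathsf{Ent}_d(L)$ with $F(x_i)=f_i$ and $\nabla F(x_i)=\xi_i$ for all $i\in[N]$ satisfies $f_{\mathcal I}(x)\le F(x)$ for all $x\in\Delta_d$.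
   Context: $\Delta_d=\{x\in\mathbb{R}^d: x\ge 0,\ \sum_k (x)_k=1\}$, $\operatorname{ri}(\Delta_d)$ is its relative interior (all entries positive), $\mathsf{1}_d$ the all-ones vector, $\Theta_d:=\operatorname{span}\{\mathsf{1}_d\}^\perp$, $[N]=\{1,\dots,N\}$. The operations $\exp(\cdot)$, $\log(\cdot)$ and division of vectors are entrywise. For $f:\Delta_d\to\mathbb{R}$ differentiable on $\operatorname{ri}(\Delta_d)$ (within the affine hull of $\Delta_d$), $\nabla f(x)\in\Theta_d$ denotes the tangent gradient, i.e. the unique vector of $\Theta_d$ representing the differential of $f$ along directions in $\Theta_d$. The Kullback--Leibler divergence is $D_h(x,u):=\sum_{k\in\operatorname{supp}x}(x)_k\log\frac{(x)_k}{(u)_k}$ if $\operatorname{supp}x\subseteq\operatorname{supp}u$, and $+\infty$ otherwise. The class $\mathsf{Ent}_d(L)$ consists of all functions $f:\Delta_d\to\mathbb{R}$ that are convex, continuously differentiable on $\operatorname{ri}(\Delta_d)$, and satisfy $0\le f(x)-f(u)-\langle\nabla f(u),x-u\rangle\le L\,D_h(x,u)$ for all $(x,u)\in\Delta_d\times\operatorname{ri}(\Delta_d)$. *)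

theory Defs
  imports "HOL-Analysis.Analysis"
begin

definition prob_simplex :: "(real ^ 'd) set" where
  "prob_simplex = {x. (\<forall>k. 0 \<le> x $ k) \<and> (\<Sum>k\<in>UNIV. x $ k) = 1}"

text \<open>The numeral \<open>1 :: real ^ 'd\<close> is the all-ones vector.\<close>

definition tangent_space :: "(real ^ 'd) set" where
  "tangent_space = orthogonal_comp (span {1})"

definition vec_exp :: "real ^ 'd \<Rightarrow> real ^ 'd" where
  "vec_exp v = (\<chi> k. exp (v $ k))"

definition vec_ln :: "real ^ 'd \<Rightarrow> real ^ 'd" where
  "vec_ln v = (\<chi> k. ln (v $ k))"

definition vec_div :: "real ^ 'd \<Rightarrow> real ^ 'd \<Rightarrow> real ^ 'd" where
  "vec_div v w = (\<chi> k. v $ k / w $ k)"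

definition supp :: "real ^ 'd \<Rightarrow> 'd set" where
  "supp x = {k. x $ k \<noteq> 0}"

text \<open>
  A function on the simplex is represented by a total function of which only the values on the
  simplex are relevant. In particular, derivatives are taken within the simplex; at a point of
  the relative interior this is the same as within the affine hull.
  The derivative within the simplex determines a linear form only along the tangent space,
  and requiring the representing vector to lie in that space makes it unique.
\<close>

definition has_tangent_gradient ::
    "(real ^ 'd \<Rightarrow> real) \<Rightarrow> real ^ 'd \<Rightarrow> real ^ 'd \<Rightarrow> bool" where
  "has_tangent_gradient f u \<xi> \<longleftrightarrow>
     \<xi> \<in> tangent_space \<and> (f has_derivative (\<lambda>h. \<xi> \<bullet> h)) (at u within prob_simplex)"

definition tangent_gradient :: "(real ^ 'd \<Rightarrow> real) \<Rightarrow> real ^ 'd \<Rightarrow> real ^ 'd" where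
  "tangent_gradient f u = (THE \<xi>. has_tangent_gradient f u \<xi>)"

definition KL_div :: "real ^ 'd \<Rightarrow> real ^ 'd \<Rightarrow> ereal" where
  "KL_div x u =
     (if supp x \<subseteq> supp u then ereal (\<Sum>k\<in>supp x. x $ k * ln (x $ k / u $ k)) else \<infinity>)"

definition Ent :: "real \<Rightarrow> (real ^ 'd \<Rightarrow> real) set" where
  "Ent L = {f.
     convex_on prob_simplex f \<and>
     (\<forall>u \<in> rel_interior prob_simplex. f differentiable (at u within prob_simplex)) \<and>
     continuous_on (rel_interior prob_simplex) (tangent_gradient f) \<and>
     (\<forall>x \<in> prob_simplex. \<forall>u \<in> rel_interior prob_simplex.
        0 \<le> f x - f u - tangent_gradient f u \<bullet> (x - u) \<and>
        ereal (f x - f u - tangent_gradient f u \<bullet> (x - u)) \<le> ereal L * KL_div x u)}"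

definition interpolates ::
    "nat \<Rightarrow> (nat \<Rightarrow> real ^ 'd) \<Rightarrow> (nat \<Rightarrow> real) \<Rightarrow> (nat \<Rightarrow> real ^ 'd) \<Rightarrow> (real ^ 'd \<Rightarrow> real) \<Rightarrow> bool"
  where
  "interpolates N x f \<xi> F \<longleftrightarrow>
     (\<forall>i \<in> {1..N}. F (x i) = f i \<and> tangent_gradient F (x i) = \<xi> i)"

definition weight ::
    "real \<Rightarrow> (nat \<Rightarrow> real ^ 'd) \<Rightarrow> (nat \<Rightarrow> real) \<Rightarrow> (nat \<Rightarrow> real ^ 'd) \<Rightarrow> nat \<Rightarrow> real ^ 'd" where
  "weight L x f \<xi> i = vec_exp ((1 / L) *\<^sub>R ((f i - \<xi> i \<bullet> x i) *\<^sub>R 1 + \<xi> i))"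

definition weight_hull ::
    "real \<Rightarrow> nat \<Rightarrow> (nat \<Rightarrow> real ^ 'd) \<Rightarrow> (nat \<Rightarrow> real) \<Rightarrow> (nat \<Rightarrow> real ^ 'd) \<Rightarrow> (real ^ 'd) set" where
  "weight_hull L N x f \<xi> = convex hull (weight L x f \<xi> ` {1..N})"

text \<open>
  The operator \<open>GREATEST\<close> denotes an honest maximum and is unspecified if there is none, so
  attainment has to be stated separately.
\<close>

definition min_interpolant ::
    "real \<Rightarrow> nat \<Rightarrow> (nat \<Rightarrow> real ^ 'd) \<Rightarrow> (nat \<Rightarrow> real) \<Rightarrow> (nat \<Rightarrow> real ^ 'd) \<Rightarrow> real ^ 'd \<Rightarrow> real" where
  "min_interpolant L N x f \<xi> y =
     L * (GREATEST m. m \<in> (\<lambda>w. y \<bullet> vec_ln w) ` weight_hull L N x f \<xi>)"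

end

theory Submission
  imports Defs
begin

text \<open>
  Both the smoothness of the interpolant and its minimality come from one dual description of the
  Kullback--Leibler divergence, the Gibbs variational principle
  \<open>inner_le_one_iff_inner_vec_ln_le_KL_div\<close>: for positive \<open>u\<close> and \<open>p\<close>, the functional
  \<open>y \<bullet> vec_ln p\<close> is dominated by \<open>KL_div y u\<close> on the simplex if and only if \<open>u \<bullet> p \<le> 1\<close>. The
  second condition is linear in \<open>p\<close>, and this is why the convex hull of the weights, and not the
  hull of their logarithms, is the right set to maximize over.

  The points \<open>w\<close> of a compact convex set \<open>W\<close> of positive vectors give linear functionals
  \<open>L * (y \<bullet> vec_ln w)\<close>, and the interpolant is their maximum, hence convex. By concavity of the
  logarithm, \<open>w\<close> is a maximizer at \<open>u\<close> precisely when \<open>u \<bullet> vec_div v w \<le> 1\<close> for all \<open>v \<in> W\<close>. With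
  \<open>p = vec_div v w\<close> this is the condition in the Gibbs principle, so the maximum exceeds the
  functional of \<open>w\<close> by at most \<open>L * KL_div y u\<close> (\<open>log_support_error_bounds\<close>). Since the divergence
  is quadratically small near \<open>u\<close>, the maximum is differentiable at \<open>u\<close>, and its gradient is the
  tangential part of \<open>L *\<^sub>R vec_ln w\<close>. Adding the optimality conditions at two points shows that
  \<open>w\<close>, and thus the gradient, depends continuously on \<open>u\<close> (\<open>log_maximizer_stability\<close>).

  The hypothesis on the data is the optimality condition for the weight number \<open>i\<close> at \<open>x i\<close>, first
  against the other weights and then, by linearity, against their hull. The functional of this
  weight is the affine function with the prescribed value and gradient, so the maximum interpolates.

  Conversely, let \<open>F\<close> be a relatively smooth interpolating function. By convexity it dominates the
  functional of each weight. At an interior point \<open>u\<close>, relative smoothness bounds \<open>F\<close> from above by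
  its own tangent plus \<open>L * KL_div y u\<close>. Comparing the two bounds and reading the Gibbs principle in
  the other direction gives a linear inequality for each weight, which therefore extends to the
  hull and returns \<open>L * (u \<bullet> vec_ln w) \<le> F u\<close> for each \<open>w\<close> in it
  (\<open>Ent_minorant_convex_hull_interior\<close>). Convexity of \<open>F\<close> carries the inequality to the boundary.
\<close>

section \<open>The simplex and its tangent gradients\<close>

definition positive_orthant :: "(real ^ 'd) set" where
  "positive_orthant = {w. \<forall>k. 0 < w $ k}"

lemma positive_orthant_nonzero: "w \<in> positive_orthant \<Longrightarrow> w $ k \<noteq> 0"
  by (simp add: positive_orthant_def less_imp_neq[symmetric])

lemma convex_positive_orthant: "convex (positive_orthant :: (real ^ 'd) set)"
proof (rule convexI)
  fix x y :: "real ^ 'd" and a b :: real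
  assume xy: "x \<in> positive_orthant" "y \<in> positive_orthant" and ab: "0 \<le> a" "0 \<le> b" "a + b = 1"
  have "0 < a * x $ k + b * y $ k" for k
  proof (cases "a = 0")
    case True
    then show ?thesis using xy ab by (simp add: positive_orthant_def)
  next
    case False
    then have "0 < a * x $ k" using xy ab by (simp add: positive_orthant_def)
    moreover have "0 \<le> b * y $ k" using xy ab by (simp add: positive_orthant_def less_imp_le)
    ultimately show ?thesis by linarith
  qed
  then show "a *\<^sub>R x + b *\<^sub>R y \<in> positive_orthant"
    by (simp add: positive_orthant_def)
qed

lemma inner_one_eq_sum: "(y :: real ^ 'd) \<bullet> 1 = (\<Sum>k\<in>UNIV. y $ k)"
  by (simp add: inner_vec_def)

lemma prob_simplex_nonneg: "y \<in> prob_simplex \<Longrightarrow> 0 \<le> y $ k"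
  by (simp add: prob_simplex_def)

lemma prob_simplex_sum: "y \<in> prob_simplex \<Longrightarrow> (\<Sum>k\<in>UNIV. y $ k) = 1"
  by (simp add: prob_simplex_def)

lemma prob_simplex_inner_one: "y \<in> prob_simplex \<Longrightarrow> y \<bullet> 1 = 1"
  by (simp add: inner_one_eq_sum prob_simplex_sum)

lemma convex_prob_simplex: "convex (prob_simplex :: (real ^ 'd) set)"
  by (rule convexI)
    (simp add: prob_simplex_def sum.distrib flip: sum_distrib_left)

lemma rel_interior_prob_simplex_subset:
  "rel_interior prob_simplex \<subseteq> (prob_simplex \<inter> positive_orthant :: (real ^ 'd) set)"
proof
  fix u :: "real ^ 'd"
  assume u: "u \<in> rel_interior prob_simplex"
  define c :: "real ^ 'd" where "c = (\<chi> k. 1 / real CARD('d))"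
  have c: "c \<in> prob_simplex"
    by (simp add: c_def prob_simplex_def)
  have "(prob_simplex :: (real ^ 'd) set) \<noteq> {}"
    using c by blast
  \<comment> \<open>Prolong the segment from the barycentre to \<open>u\<close> slightly beyond \<open>u\<close>.\<close>
  then obtain e where e: "e > 1" "(1 - e) *\<^sub>R c + e *\<^sub>R u \<in> prob_simplex"
    using u c convex_rel_interior_iff[OF convex_prob_simplex] by blast
  have "0 < u $ k" for k
  proof -
    have "0 \<le> (1 - e) * c $ k + e * u $ k"
      using prob_simplex_nonneg[OF e(2), of k] by simp
    moreover have "(1 - e) * c $ k < 0"
      using e(1) by (simp add: c_def divide_less_0_iff)
    ultimately have "0 < e * u $ k"
      by linarith
    then show ?thesis
      using e(1) by (simp add: zero_less_mult_iff)
  qed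
  then show "u \<in> prob_simplex \<inter> positive_orthant"
    using u rel_interior_subset[of prob_simplex] by (auto simp: positive_orthant_def)
qed

lemma tangent_space_iff: "v \<in> tangent_space \<longleftrightarrow> v \<bullet> (1 :: real ^ 'd) = 0"
proof
  assume "v \<in> tangent_space"
  then show "v \<bullet> 1 = 0"
    by (auto simp: tangent_space_def orthogonal_comp_def orthogonal_def span_base inner_commute)
next
  assume "v \<bullet> 1 = 0"
  then show "v \<in> tangent_space"
    by (auto simp: tangent_space_def orthogonal_comp_def orthogonal_def span_singleton inner_commute)
qed

definition tangent_part :: "real ^ 'd \<Rightarrow> real ^ 'd" where
  "tangent_part v = v - ((v \<bullet> 1) / (1 \<bullet> (1 :: real ^ 'd))) *\<^sub>R 1"

lemma inner_one_one_pos: "0 < (1 :: real ^ 'd) \<bullet> 1"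
  by (simp add: inner_one_eq_sum)

lemma tangent_part_mem: "tangent_part v \<in> tangent_space"
  using inner_one_one_pos
  by (simp add: tangent_space_iff tangent_part_def inner_diff_left less_imp_neq[symmetric])

lemma tangent_part_inner_diff:
  assumes "y \<in> prob_simplex" "u \<in> prob_simplex"
  shows "tangent_part v \<bullet> (y - u) = v \<bullet> (y - u)"
proof -
  have "1 \<bullet> (y - u) = 0"
    using assms by (simp add: inner_diff_right prob_simplex_inner_one inner_commute[of 1])
  then show ?thesis
    by (simp add: tangent_part_def inner_diff_left)
qed

lemma tangent_part_shift:
  assumes "\<xi> \<in> tangent_space"
  shows "tangent_part (r *\<^sub>R 1 + \<xi>) = \<xi>"
  using assms inner_one_one_pos
  by (simp add: tangent_part_def tangent_space_iff inner_add_left less_imp_neq[symmetric])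

text \<open>
  Two tangent gradients at a point of the open simplex differ by a tangent vector \<open>\<eta>\<close>, and the
  segment from the point in direction \<open>\<eta>\<close> stays in the simplex for a short time, so that the
  derivative along it is determined by the function.
\<close>
lemma has_tangent_gradient_unique:
  fixes u :: "real ^ 'd"
  assumes u: "u \<in> rel_interior prob_simplex"
    and g: "has_tangent_gradient f u g" and g': "has_tangent_gradient f u g'"
  shows "g = g'"
proof -
  define \<eta> where "\<eta> = g - g'"
  have u': "u \<in> prob_simplex" "\<And>k. 0 < u $ k"
    using u rel_interior_prob_simplex_subset by (auto simp: positive_orthant_def)
  have eta: "(\<Sum>k\<in>UNIV. \<eta> $ k) = 0"
    unfolding inner_one_eq_sum[symmetric] \<eta>_def using g g'
    by (simp add: has_tangent_gradient_def tangent_space_iff inner_diff_left)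
  \<comment> \<open>The summand \<open>1\<close> only avoids a division by zero when \<open>\<eta> = 0\<close>.\<close>
  define e where "e = Min (range (\<lambda>k. u $ k)) / (1 + norm \<eta>)"
  have min_pos: "0 < Min (range (\<lambda>k. u $ k))"
    using u'(2) by (subst Min_gr_iff) auto
  then have e: "0 < e"
    by (simp add: e_def add_pos_nonneg)
  have inS: "u + t *\<^sub>R \<eta> \<in> prob_simplex" if t: "t \<in> {0..e}" for t
  proof -
    have "0 \<le> u $ k + t * \<eta> $ k" for k
    proof -
      have "\<bar>t * \<eta> $ k\<bar> \<le> e * (1 + norm \<eta>)"
        unfolding abs_mult using t component_le_norm_cart[of \<eta> k]
        by (intro mult_mono) auto
      also have "\<dots> = Min (range (\<lambda>k. u $ k))"
        using norm_ge_zero[of \<eta>] by (simp add: e_def add_pos_nonneg less_imp_neq[symmetric])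
      also have "\<dots> \<le> u $ k"
        by (intro Min_le) auto
      finally show ?thesis by linarith
    qed
    then show ?thesis
      using u'(1) eta by (simp add: prob_simplex_def sum.distrib flip: sum_distrib_left)
  qed
  have "((\<lambda>_. 0) has_derivative (\<lambda>h. \<eta> \<bullet> h)) (at u within prob_simplex)"
    using has_derivative_diff[of f "\<lambda>h. g \<bullet> h" "at u within prob_simplex" f "\<lambda>h. g' \<bullet> h"] g g'
    by (simp add: has_tangent_gradient_def \<eta>_def inner_diff_left)
  then have "((\<lambda>_. 0 :: real) has_derivative (\<lambda>h. \<eta> \<bullet> h))
      (at (u + 0 *\<^sub>R \<eta>) within (\<lambda>t. u + t *\<^sub>R \<eta>) ` {0..e})"
    using inS by (auto intro: has_derivative_subset)
  moreover have "((\<lambda>t. u + t *\<^sub>R \<eta>) has_derivative (\<lambda>t. t *\<^sub>R \<eta>)) (at 0 within {0..e})"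
    by (auto intro!: derivative_eq_intros)
  ultimately have "((\<lambda>_. 0 :: real) has_derivative (\<lambda>t. \<eta> \<bullet> (t *\<^sub>R \<eta>))) (at 0 within {0..e})"
    by (rule has_derivative_in_compose[where g = "\<lambda>_. 0" and f = "\<lambda>t. u + t *\<^sub>R \<eta>", rotated])
  then have "((\<lambda>_. 0 :: real) has_real_derivative \<eta> \<bullet> \<eta>) (at 0 within {0..e})"
    by (simp add: has_field_derivative_def mult.commute[of _ "\<eta> \<bullet> \<eta>"])
  then have "((\<lambda>_. 0 :: real) has_vector_derivative \<eta> \<bullet> \<eta>) (at 0 within cbox 0 e)"
    by (simp add: has_real_derivative_iff_has_vector_derivative)
  moreover have "((\<lambda>_. 0 :: real) has_vector_derivative 0) (at 0 within cbox 0 e)"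
    by simp
  ultimately have "\<eta> \<bullet> \<eta> = 0"
    using e by (intro vector_derivative_unique_within_closed_interval[of 0 e 0 "\<lambda>_. 0 :: real"]) auto
  then show ?thesis
    by (simp add: \<eta>_def)
qed

lemma tangent_gradient_eqI:
  assumes "u \<in> rel_interior prob_simplex" "has_tangent_gradient f u g"
  shows "tangent_gradient f u = g"
  unfolding tangent_gradient_def
  using assms has_tangent_gradient_unique by (intro the_equality) blast+

lemma has_tangent_gradient_if_quadratic_error:
  assumes g: "g \<in> tangent_space"
    and bound: "\<And>y. y \<in> prob_simplex \<Longrightarrow> \<bar>f y - f u - g \<bullet> (y - u)\<bar> \<le> C * (norm (y - u))\<^sup>2"
  shows "has_tangent_gradient f u g"
proof -
  have "((\<lambda>y. norm (f y - f u - g \<bullet> (y - u)) / norm (y - u)) \<longlongrightarrow> 0) (at u within prob_simplex)"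
  proof (rule Lim_null_comparison)
    show "\<forall>\<^sub>F y in at u within prob_simplex.
        norm (norm (f y - f u - g \<bullet> (y - u)) / norm (y - u)) \<le> C * norm (y - u)"
      unfolding eventually_at_filter
    proof (intro always_eventually allI impI)
      fix y assume "y \<noteq> u" "y \<in> prob_simplex"
      then show "norm (norm (f y - f u - g \<bullet> (y - u)) / norm (y - u)) \<le> C * norm (y - u)"
        using bound[of y] by (simp add: divide_simps power2_eq_square mult.assoc)
    qed
    have "((\<lambda>y. C * norm (y - u)) \<longlongrightarrow> C * norm (u - u)) (at u within prob_simplex)"
      by (intro tendsto_intros)
    then show "((\<lambda>y. C * norm (y - u)) \<longlongrightarrow> 0) (at u within prob_simplex)"
      by simp
  qed
  then show ?thesis
    using g by (simp add: has_tangent_gradient_def has_derivative_iff_norm bounded_linear_inner_right)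
qed

section \<open>The Kullback--Leibler divergence\<close>

lemma vec_ln_vec_div:
  assumes "a \<in> positive_orthant" "b \<in> positive_orthant"
  shows "vec_ln (vec_div a b) = vec_ln a - vec_ln b"
  using assms
  by (simp add: vec_ln_def vec_div_def positive_orthant_def vec_eq_iff ln_div less_imp_neq[symmetric])

lemma vec_div_positive:
  assumes "a \<in> positive_orthant" "b \<in> positive_orthant"
  shows "vec_div a b \<in> positive_orthant"
  using assms by (simp add: vec_div_def positive_orthant_def)

lemma KL_div_positive:
  fixes u :: "real ^ 'd"
  assumes "u \<in> positive_orthant"
  shows "KL_div y u = ereal (\<Sum>k\<in>UNIV. y $ k * ln (y $ k / u $ k))"
proof -
  have "supp u = UNIV"
    using assms by (auto simp: supp_def positive_orthant_def less_imp_neq[symmetric])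
  moreover have "(\<Sum>k\<in>supp y. y $ k * ln (y $ k / u $ k)) = (\<Sum>k\<in>UNIV. y $ k * ln (y $ k / u $ k))"
    by (rule sum.mono_neutral_left) (auto simp: supp_def)
  ultimately show ?thesis
    by (simp add: KL_div_def)
qed

text \<open>
  This is the Gibbs variational principle: the supremum over \<open>y\<close> of
  \<open>y \<bullet> vec_ln p - KL_div y u\<close> is \<open>ln (u \<bullet> p)\<close>, attained at the tilted distribution
  proportional to \<open>u $ k * p $ k\<close>.
\<close>
lemma inner_le_one_iff_inner_vec_ln_le_KL_div:
  fixes u p :: "real ^ 'd"
  assumes u: "u \<in> positive_orthant" and p: "p \<in> positive_orthant"
  shows "u \<bullet> p \<le> 1 \<longleftrightarrow> (\<forall>y\<in>prob_simplex. ereal (y \<bullet> vec_ln p) \<le> KL_div y u)"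
proof
  have pos: "0 < u $ k" "0 < p $ k" for k
    using u p by (auto simp: positive_orthant_def)
  show "\<forall>y\<in>prob_simplex. ereal (y \<bullet> vec_ln p) \<le> KL_div y u" if le: "u \<bullet> p \<le> 1"
  proof
    fix y :: "real ^ 'd" assume y: "y \<in> prob_simplex"
    \<comment> \<open>Young's inequality for the entropy, which is \<open>ln t \<le> t - 1\<close> at \<open>t = u $ k * p $ k / y $ k\<close>.\<close>
    have "y $ k * ln (p $ k) \<le> y $ k * ln (y $ k / u $ k) + (u $ k * p $ k - y $ k)" for k
    proof (cases "y $ k = 0")
      case True
      then show ?thesis using pos[of k] by simp
    next
      case False
      then have yk: "0 < y $ k"
        using prob_simplex_nonneg[OF y, of k] by simp
      have "ln (u $ k * p $ k / y $ k) \<le> u $ k * p $ k / y $ k - 1"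
        using yk pos[of k] by (intro ln_le_minus_one) simp
      then have "y $ k * ln (u $ k * p $ k / y $ k) \<le> y $ k * (u $ k * p $ k / y $ k - 1)"
        using yk by (intro mult_left_mono) auto
      moreover have "y $ k * (u $ k * p $ k / y $ k - 1) = u $ k * p $ k - y $ k"
        using yk by (simp add: field_simps)
      moreover have "ln (u $ k * p $ k / y $ k) = ln (p $ k) - ln (y $ k / u $ k)"
        using yk pos[of k] by (simp add: ln_div ln_mult)
      ultimately show ?thesis
        by (simp add: right_diff_distrib)
    qed
    then have "y \<bullet> vec_ln p \<le> (\<Sum>k\<in>UNIV. y $ k * ln (y $ k / u $ k) + (u $ k * p $ k - y $ k))"
      by (simp add: inner_vec_def vec_ln_def sum_mono)
    also have "\<dots> = (\<Sum>k\<in>UNIV. y $ k * ln (y $ k / u $ k)) + (u \<bullet> p - 1)"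
      by (simp add: sum.distrib sum_subtractf inner_vec_def prob_simplex_sum[OF y])
    finally show "ereal (y \<bullet> vec_ln p) \<le> KL_div y u"
      using le by (simp add: KL_div_positive[OF u])
  qed
  \<comment> \<open>Testing with the tilted distribution turns the inequality into \<open>ln (u \<bullet> p) \<le> 0\<close>.\<close>
  show "u \<bullet> p \<le> 1" if all: "\<forall>y\<in>prob_simplex. ereal (y \<bullet> vec_ln p) \<le> KL_div y u"
  proof -
    define s where "s = u \<bullet> p"
    have s: "0 < s"
      using pos by (simp add: s_def inner_vec_def sum_pos)
    define y :: "real ^ 'd" where "y = (\<chi> k. u $ k * p $ k / s)"
    have y: "y \<in> prob_simplex"
      using s pos by (auto simp: y_def prob_simplex_def less_imp_le s_def inner_vec_def
          simp flip: sum_divide_distrib)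
    have "(\<Sum>k\<in>UNIV. y $ k * ln (y $ k / u $ k)) = (\<Sum>k\<in>UNIV. y $ k * ln (p $ k) - y $ k * ln s)"
    proof (rule sum.cong[OF refl])
      fix k
      have "y $ k / u $ k = p $ k / s"
        using pos[of k] by (simp add: y_def)
      then show "y $ k * ln (y $ k / u $ k) = y $ k * ln (p $ k) - y $ k * ln s"
        using pos[of k] s by (simp add: ln_div right_diff_distrib)
    qed
    also have "\<dots> = y \<bullet> vec_ln p - ln s"
      by (simp add: sum_subtractf inner_vec_def vec_ln_def prob_simplex_sum[OF y]
          flip: sum_distrib_right)
    finally have "y \<bullet> vec_ln p \<le> y \<bullet> vec_ln p - ln s"
      using all y by (auto simp: KL_div_positive[OF u])
    then show ?thesis
      using s by (simp add: s_def)
  qed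
qed

text \<open>Bounding the logarithm by \<open>ln t \<le> t - 1\<close> replaces the divergence by the chi-square distance.\<close>
lemma KL_div_le_quadratic:
  fixes u y :: "real ^ 'd"
  assumes u: "u \<in> prob_simplex" "u \<in> positive_orthant" and y: "y \<in> prob_simplex"
  shows "KL_div y u \<le> ereal ((\<Sum>k\<in>UNIV. 1 / u $ k) * (norm (y - u))\<^sup>2)"
proof -
  have pos: "0 < u $ k" for k
    using u by (simp add: positive_orthant_def)
  have "y $ k * ln (y $ k / u $ k) \<le> 1 / u $ k * (norm (y - u))\<^sup>2 + (y $ k - u $ k)" for k
  proof -
    have "y $ k * ln (y $ k / u $ k) \<le> y $ k * (y $ k / u $ k - 1)"
    proof (cases "y $ k = 0")
      case False
      then have yk: "0 < y $ k"
        using prob_simplex_nonneg[OF y, of k] by simp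
      then show ?thesis
        using pos[of k] by (intro mult_left_mono ln_le_minus_one) auto
    qed simp
    also have "\<dots> = 1 / u $ k * (y $ k - u $ k)\<^sup>2 + (y $ k - u $ k)"
      using pos[of k] by (simp add: field_simps power2_eq_square)
    also have "(y $ k - u $ k)\<^sup>2 \<le> (norm (y - u))\<^sup>2"
      using component_le_norm_cart[of "y - u" k]
        by (metis abs_le_square_iff abs_norm_cancel vector_minus_component)
    finally show ?thesis
      using pos[of k] by (simp add: mult_left_mono divide_right_mono)
  qed
  then have "(\<Sum>k\<in>UNIV. y $ k * ln (y $ k / u $ k))
      \<le> (\<Sum>k\<in>UNIV. 1 / u $ k * (norm (y - u))\<^sup>2 + (y $ k - u $ k))"
    by (rule sum_mono)
  also have "\<dots> = (\<Sum>k\<in>UNIV. 1 / u $ k) * (norm (y - u))\<^sup>2"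
    by (simp add: sum.distrib sum_subtractf prob_simplex_sum[OF y] prob_simplex_sum[OF u(1)]
        sum_distrib_right)
  finally show ?thesis
    by (simp add: KL_div_positive[OF u(2)])
qed

section \<open>Maximizers of logarithmic functionals\<close>

definition log_maximizer :: "(real ^ 'd) set \<Rightarrow> real ^ 'd \<Rightarrow> real ^ 'd \<Rightarrow> bool" where
  "log_maximizer W y w \<longleftrightarrow> w \<in> W \<and> (\<forall>v\<in>W. y \<bullet> vec_ln v \<le> y \<bullet> vec_ln w)"

lemma log_maximizer_exists:
  fixes W :: "(real ^ 'd) set"
  assumes "compact W" "W \<noteq> {}" "W \<subseteq> positive_orthant"
  shows "\<exists>w. log_maximizer W y w"
proof -
  have "continuous_on W (\<lambda>w. \<Sum>k\<in>UNIV. y $ k * ln (w $ k))"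
    using assms(3) by (intro continuous_intros ballI positive_orthant_nonzero) auto
  then have "continuous_on W (\<lambda>w. y \<bullet> vec_ln w)"
    by (simp add: inner_vec_def vec_ln_def)
  then show ?thesis
    using continuous_attains_sup[OF assms(1,2)] by (auto simp: log_maximizer_def)
qed

text \<open>Concavity of the logarithm in the form \<open>ln t \<le> t - 1\<close>.\<close>
lemma inner_vec_ln_le_if_inner_vec_div_le_one:
  assumes u: "u \<in> prob_simplex" and w: "w \<in> positive_orthant" and v: "v \<in> positive_orthant"
    and le: "u \<bullet> vec_div v w \<le> 1"
  shows "u \<bullet> vec_ln v \<le> u \<bullet> vec_ln w"
proof -
  have pos: "0 < vec_div v w $ k" for k
    using vec_div_positive[OF v w] by (simp add: positive_orthant_def)
  have "u \<bullet> vec_ln (vec_div v w) \<le> u \<bullet> (vec_div v w - 1)"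
    unfolding inner_vec_def
    by (intro sum_mono) (simp add: vec_ln_def pos mult_left_mono prob_simplex_nonneg[OF u] ln_le_minus_one)
  also have "\<dots> \<le> 0"
    using le by (simp add: inner_diff_right prob_simplex_inner_one[OF u])
  finally show ?thesis
    by (simp add: vec_ln_vec_div v w inner_diff_right)
qed

text \<open>
  First-order optimality: along the segment from the maximizer \<open>w\<close> to \<open>v\<close> the functional cannot
  start to increase, and its initial slope is \<open>u \<bullet> vec_div v w - 1\<close>.
\<close>
lemma log_maximizer_inner_vec_div_le_one:
  fixes W :: "(real ^ 'd) set"
  assumes W: "convex W" "W \<subseteq> positive_orthant" and u: "u \<in> prob_simplex"
    and w: "log_maximizer W u w" and v: "v \<in> W"
  shows "u \<bullet> vec_div v w \<le> 1"
proof (rule ccontr)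
  assume "\<not> ?thesis"
  then have gt: "1 < u \<bullet> vec_div v w"
    by simp
  have wW: "w \<in> W" and pos: "\<And>k. 0 < w $ k"
    using w W by (auto simp: log_maximizer_def positive_orthant_def)
  define \<phi> where "\<phi> t = (\<Sum>k\<in>UNIV. u $ k * ln (w $ k + t * (v $ k - w $ k)))" for t
  have "(\<phi> has_real_derivative (\<Sum>k\<in>UNIV. u $ k * ((v $ k - w $ k) / w $ k))) (at 0)"
    unfolding \<phi>_def using pos
    by (auto intro!: derivative_eq_intros sum.cong simp: less_imp_neq[symmetric])
  moreover have "(\<Sum>k\<in>UNIV. u $ k * ((v $ k - w $ k) / w $ k)) = u \<bullet> vec_div v w - 1"
  proof -
    have "u $ k * ((v $ k - w $ k) / w $ k) = u $ k * (v $ k / w $ k) - u $ k" for k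
      using pos[of k] by (simp add: field_simps)
    then show ?thesis
      by (simp add: inner_vec_def vec_div_def sum_subtractf prob_simplex_sum[OF u])
  qed
  ultimately obtain d where d: "d > 0" "\<And>h. 0 < h \<Longrightarrow> h < d \<Longrightarrow> \<phi> 0 < \<phi> (0 + h)"
    using DERIV_pos_inc_right[of \<phi> "u \<bullet> vec_div v w - 1" 0] gt by auto
  define h where "h = min 1 (d / 2)"
  have h: "0 < h" "h < d" "h \<le> 1"
    using d(1) by (auto simp: h_def)
  have "(1 - h) *\<^sub>R w + h *\<^sub>R v \<in> W"
    using W(1) wW v h by (intro convexD) auto
  then have "u \<bullet> vec_ln ((1 - h) *\<^sub>R w + h *\<^sub>R v) \<le> u \<bullet> vec_ln w"
    using w by (auto simp: log_maximizer_def)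
  moreover have "u \<bullet> vec_ln ((1 - h) *\<^sub>R w + h *\<^sub>R v) = \<phi> h"
    by (simp add: \<phi>_def inner_vec_def vec_ln_def algebra_simps)
  moreover have "u \<bullet> vec_ln w = \<phi> 0"
    by (simp add: \<phi>_def inner_vec_def vec_ln_def)
  ultimately show False
    using d(2)[OF h(1,2)] by simp
qed

text \<open>
  This lets optimality conditions checked on generators extend to the convex hull.
\<close>
lemma convex_inner_vec_div_le: "convex {w. (u :: real ^ 'd) \<bullet> vec_div w v \<le> c}"
proof (rule convexI)
  fix a b :: "real ^ 'd" and s t :: real
  assume *: "a \<in> {w. u \<bullet> vec_div w v \<le> c}" "b \<in> {w. u \<bullet> vec_div w v \<le> c}"
    "0 \<le> s" "0 \<le> t" "s + t = 1"
  have "u \<bullet> vec_div (s *\<^sub>R a + t *\<^sub>R b) v = s * (u \<bullet> vec_div a v) + t * (u \<bullet> vec_div b v)"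
    by (simp add: inner_vec_def vec_div_def sum_distrib_left add_divide_distrib sum.distrib algebra_simps)
  also have "\<dots> \<le> c"
    using * by (intro convex_bound_le) auto
  finally show "s *\<^sub>R a + t *\<^sub>R b \<in> {w. u \<bullet> vec_div w v \<le> c}"
    by simp
qed

text \<open>
  With \<open>t $ k = wv $ k / wu $ k\<close>, the optimality conditions say \<open>u \<bullet> t \<le> 1\<close> and
  \<open>v \<bullet> (1 / t) \<le> 1\<close>. Adding them leaves the sum of \<open>u $ k * (t $ k + 1 / t $ k - 2)\<close>, whose terms
  are nonnegative and, where \<open>u $ k > 0\<close>, vanish only at \<open>t $ k = 1\<close>, bounded by the sum of
  \<open>(u $ k - v $ k) / t $ k\<close>. This makes the maximizer unique at a positive \<open>u\<close> and quantifies
  how it moves with \<open>u\<close>.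
\<close>
lemma log_maximizer_stability:
  fixes W :: "(real ^ 'd) set"
  assumes W: "convex W" "W \<subseteq> positive_orthant"
    and a: "0 < a" "\<And>w k. w \<in> W \<Longrightarrow> a \<le> w $ k" and b: "\<And>w k. w \<in> W \<Longrightarrow> w $ k \<le> b"
    and u: "u \<in> prob_simplex" "log_maximizer W u wu"
    and v: "v \<in> prob_simplex" "log_maximizer W v wv"
  shows "u $ i * (wv $ i - wu $ i)\<^sup>2 \<le> b\<^sup>2 * ((b / a) * (\<Sum>k\<in>UNIV. \<bar>u $ k - v $ k\<bar>))"
proof -
  have wu: "wu \<in> W" and wv: "wv \<in> W"
    using u v by (auto simp: log_maximizer_def)
  have pos: "0 < wu $ k" "0 < wv $ k" for k
    using a wu wv by (meson less_le_trans)+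
  have b0: "0 < b"
    using pos(1) b[OF wu] by (meson less_le_trans)
  let ?q = "\<lambda>k. u $ k * ((wv $ k - wu $ k)\<^sup>2 / (wu $ k * wv $ k))"
  have q0: "0 \<le> ?q k" for k
    using pos[of k] prob_simplex_nonneg[OF u(1), of k] by simp
  have "?q i \<le> (\<Sum>k\<in>UNIV. ?q k)"
    using q0 by (intro member_le_sum) auto
  also have "\<dots> = u \<bullet> vec_div wv wu + v \<bullet> vec_div wu wv - 2
      + (\<Sum>k\<in>UNIV. (u $ k - v $ k) * (wu $ k / wv $ k))"
  proof -
    have "?q k = u $ k * (wv $ k / wu $ k) + v $ k * (wu $ k / wv $ k) - 2 * u $ k
        + (u $ k - v $ k) * (wu $ k / wv $ k)" for k
      using pos[of k] by (simp add: field_simps power2_eq_square)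
    then show ?thesis
      by (simp add: sum.distrib sum_subtractf inner_vec_def vec_div_def prob_simplex_sum[OF u(1)]
          flip: sum_distrib_left)
  qed
  also have "\<dots> \<le> (\<Sum>k\<in>UNIV. (u $ k - v $ k) * (wu $ k / wv $ k))"
    using log_maximizer_inner_vec_div_le_one[OF W u wv] log_maximizer_inner_vec_div_le_one[OF W v wu]
    by simp
  also have "\<dots> \<le> (\<Sum>k\<in>UNIV. \<bar>u $ k - v $ k\<bar> * (b / a))"
  proof (rule sum_mono)
    fix k
    have "(u $ k - v $ k) * (wu $ k / wv $ k) \<le> \<bar>u $ k - v $ k\<bar> * (wu $ k / wv $ k)"
      using pos[of k] by (intro mult_right_mono) auto
    also have "\<dots> \<le> \<bar>u $ k - v $ k\<bar> * (b / a)"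
      using a(1) a(2)[OF wv, of k] b[OF wu, of k] b0 by (intro mult_left_mono frac_le) auto
    finally show "(u $ k - v $ k) * (wu $ k / wv $ k) \<le> \<bar>u $ k - v $ k\<bar> * (b / a)" .
  qed
  finally have q: "?q i \<le> (b / a) * (\<Sum>k\<in>UNIV. \<bar>u $ k - v $ k\<bar>)"
    by (simp add: sum_distrib_left mult.commute)
  have "u $ i * (wv $ i - wu $ i)\<^sup>2 = (wu $ i * wv $ i) * ?q i"
    using pos[of i] by (simp add: field_simps)
  also have "\<dots> \<le> b\<^sup>2 * ?q i"
    using b[OF wu, of i] b[OF wv, of i] pos[of i] q0 b0
    by (intro mult_right_mono) (auto simp: power2_eq_square intro!: mult_mono)
  also have "\<dots> \<le> b\<^sup>2 * ((b / a) * (\<Sum>k\<in>UNIV. \<bar>u $ k - v $ k\<bar>))"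
    using q by (intro mult_left_mono) auto
  finally show ?thesis .
qed

lemma compact_positive_bounds:
  fixes W :: "(real ^ 'd) set"
  assumes "compact W" "W \<subseteq> positive_orthant"
  obtains a b where "0 < a" "\<And>w k. w \<in> W \<Longrightarrow> a \<le> w $ k" "\<And>w k. w \<in> W \<Longrightarrow> w $ k \<le> b"
proof (cases "W = {}")
  case True
  then show thesis using that[of 1] by simp
next
  case False
  have "\<exists>a>0. \<forall>w\<in>W. a \<le> w $ k" for k
  proof -
    have "\<exists>w0\<in>W. \<forall>w\<in>W. w0 $ k \<le> w $ k"
      using continuous_attains_inf[OF assms(1) False, of "\<lambda>w. w $ k"] by (simp add: continuous_intros)
    then show ?thesis
      using assms(2) by (auto simp: positive_orthant_def)
  qed
  then obtain a where a: "\<And>k. 0 < a k" "\<And>k w. w \<in> W \<Longrightarrow> a k \<le> w $ k"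
    by metis
  obtain b where b: "\<And>w. w \<in> W \<Longrightarrow> norm w \<le> b"
    using compact_imp_bounded[OF assms(1)] by (auto simp: bounded_iff)
  show thesis
  proof (rule that)
    show "0 < Min (range a)"
      using a(1) by (subst Min_gr_iff) auto
    show "Min (range a) \<le> w $ k" if "w \<in> W" for w k
      using a(2)[OF that, of k] by (intro order_trans[OF Min_le]) auto
    show "w $ k \<le> b" if "w \<in> W" for w k
      using b[OF that] component_le_norm_cart[of w k] by linarith
  qed
qed

lemma continuous_on_log_maximizer:
  fixes W :: "(real ^ 'd) set"
  assumes W: "convex W" "W \<subseteq> positive_orthant" "compact W"
    and m: "\<And>u. u \<in> S \<Longrightarrow> log_maximizer W u (m u)"
    and S: "S \<subseteq> prob_simplex \<inter> positive_orthant"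
  shows "continuous_on S m"
  unfolding continuous_on_def
proof
  fix u assume u: "u \<in> S"
  obtain a b where ab: "0 < a" "\<And>w k. w \<in> W \<Longrightarrow> a \<le> w $ k" "\<And>w k. w \<in> W \<Longrightarrow> w $ k \<le> b"
    using compact_positive_bounds[OF W(3,2)] by metis
  show "(m \<longlongrightarrow> m u) (at u within S)"
  proof (rule vec_tendstoI)
    fix i
    let ?B = "\<lambda>v. b\<^sup>2 * ((b / a) * (\<Sum>k\<in>UNIV. \<bar>u $ k - v $ k\<bar>)) / u $ i"
    have ui: "0 < u $ i"
      using u S by (auto simp: positive_orthant_def)
    have "((\<lambda>v. (m v $ i - m u $ i)\<^sup>2) \<longlongrightarrow> 0) (at u within S)"
    proof (rule Lim_null_comparison)
      show "\<forall>\<^sub>F v in at u within S. norm ((m v $ i - m u $ i)\<^sup>2) \<le> ?B v"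
        unfolding eventually_at_filter
      proof (intro always_eventually allI impI)
        fix v assume v: "v \<in> S"
        have "u \<in> prob_simplex" "v \<in> prob_simplex"
          using u v S by auto
        then have "u $ i * (m v $ i - m u $ i)\<^sup>2 \<le> b\<^sup>2 * ((b / a) * (\<Sum>k\<in>UNIV. \<bar>u $ k - v $ k\<bar>))"
          by (intro log_maximizer_stability[OF W(1,2) ab] m u v)
        then show "norm ((m v $ i - m u $ i)\<^sup>2) \<le> ?B v"
          using ui by (simp only: real_norm_def abs_power2 pos_le_divide_eq mult.commute)
      qed
      have "(?B \<longlongrightarrow> ?B u) (at u within S)"
        using ui by (intro tendsto_intros) simp
      then show "(?B \<longlongrightarrow> 0) (at u within S)"
        by simp
    qed
    then have "((\<lambda>v. sqrt ((m v $ i - m u $ i)\<^sup>2)) \<longlongrightarrow> sqrt 0) (at u within S)"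
      by (rule tendsto_real_sqrt)
    then have "((\<lambda>v. m v $ i - m u $ i) \<longlongrightarrow> 0) (at u within S)"
      by (simp add: tendsto_rabs_zero_iff)
    then show "((\<lambda>v. m v $ i) \<longlongrightarrow> m u $ i) (at u within S)"
      by (simp add: LIM_zero_iff)
  qed
qed

section \<open>Logarithmic support functions are relatively smooth\<close>

text \<open>
  The domain of maximization is left arbitrary; \<open>min_interpolant\<close> is the case of the weight hull.
\<close>
definition log_support :: "real \<Rightarrow> (real ^ 'd) set \<Rightarrow> real ^ 'd \<Rightarrow> real" where
  "log_support L W y = L * (GREATEST m. m \<in> (\<lambda>w. y \<bullet> vec_ln w) ` W)"

lemma log_support_eq:
  assumes "log_maximizer W y w"
  shows "log_support L W y = L * (y \<bullet> vec_ln w)"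
proof -
  have "(GREATEST m. m \<in> (\<lambda>w. y \<bullet> vec_ln w) ` W) = y \<bullet> vec_ln w"
    using assms by (intro Greatest_equality) (auto simp: log_maximizer_def)
  then show ?thesis
    by (simp add: log_support_def)
qed

lemma log_support_upper:
  assumes "compact W" "W \<subseteq> positive_orthant" "0 \<le> L" "w \<in> W"
  shows "L * (y \<bullet> vec_ln w) \<le> log_support L W y"
proof -
  obtain m where m: "log_maximizer W y m"
    using log_maximizer_exists[of W] assms by blast
  then have "y \<bullet> vec_ln w \<le> y \<bullet> vec_ln m"
    using assms(4) by (simp add: log_maximizer_def)
  then show ?thesis
    using assms(3) by (simp add: log_support_eq[OF m] mult_left_mono)
qed

lemma convex_on_log_support:
  fixes W :: "(real ^ 'd) set"
  assumes W: "compact W" "W \<noteq> {}" "W \<subseteq> positive_orthant" and L: "0 \<le> L" and S: "convex S"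
  shows "convex_on S (log_support L W)"
  unfolding convex_on_def
proof (intro conjI allI ballI impI S)
  fix y z :: "real ^ 'd" and s t :: real
  assume st: "0 \<le> s" "0 \<le> t" "s + t = 1"
  obtain w where w: "log_maximizer W (s *\<^sub>R y + t *\<^sub>R z) w"
    using log_maximizer_exists[OF W] by blast
  then have wW: "w \<in> W"
    by (simp add: log_maximizer_def)
  have "log_support L W (s *\<^sub>R y + t *\<^sub>R z) = s * (L * (y \<bullet> vec_ln w)) + t * (L * (z \<bullet> vec_ln w))"
    by (simp add: log_support_eq[OF w] inner_add_left algebra_simps)
  also have "\<dots> \<le> s * log_support L W y + t * log_support L W z"
    using st log_support_upper[OF W(1,3) L wW] by (intro add_mono mult_left_mono)
  finally show "log_support L W (s *\<^sub>R y + t *\<^sub>R z) \<le> s * log_support L W y + t * log_support L W z" .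
qed

text \<open>
  The linear functional of a maximizer at \<open>u\<close> touches the support function from below at \<open>u\<close>, so
  the error is \<open>L\<close> times the maximum over \<open>v\<close> of \<open>y \<bullet> vec_ln (vec_div v w)\<close>. The optimality
  condition \<open>u \<bullet> vec_div v w \<le> 1\<close> and the Gibbs principle bound it by the divergence.
\<close>
lemma log_support_error_bounds:
  fixes W :: "(real ^ 'd) set"
  assumes W: "convex W" "compact W" "W \<subseteq> positive_orthant" and L: "0 \<le> L"
    and u: "u \<in> prob_simplex" "u \<in> positive_orthant" and w: "log_maximizer W u w"
    and y: "y \<in> prob_simplex"
  defines "E \<equiv> log_support L W y - log_support L W u - tangent_part (L *\<^sub>R vec_ln w) \<bullet> (y - u)"
  shows "0 \<le> E" and "ereal E \<le> ereal L * KL_div y u"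
proof -
  have wW: "w \<in> W"
    using w by (simp add: log_maximizer_def)
  have E: "E = log_support L W y - L * (y \<bullet> vec_ln w)"
    unfolding E_def tangent_part_inner_diff[OF y u(1)] log_support_eq[OF w]
    by (simp add: inner_diff_right inner_commute right_diff_distrib)
  show "0 \<le> E"
    using log_support_upper[OF W(2,3) L wW, of y] by (simp add: E)
  obtain v where v: "log_maximizer W y v"
    using log_maximizer_exists[OF W(2) _ W(3)] wW by blast
  then have vW: "v \<in> W"
    by (simp add: log_maximizer_def)
  have pos: "v \<in> positive_orthant" "w \<in> positive_orthant"
    using W(3) vW wW by auto
  have "ereal (y \<bullet> vec_ln (vec_div v w)) \<le> KL_div y u"
    using inner_le_one_iff_inner_vec_ln_le_KL_div[OF u(2) vec_div_positive[OF pos]]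
      log_maximizer_inner_vec_div_le_one[OF W(1,3) u(1) w vW] y by blast
  moreover have "E = L * (y \<bullet> vec_ln (vec_div v w))"
    by (simp add: E log_support_eq[OF v] vec_ln_vec_div pos inner_diff_right right_diff_distrib)
  ultimately show "ereal E \<le> ereal L * KL_div y u"
    using L by (simp add: KL_div_positive[OF u(2)] mult_left_mono)
qed

text \<open>
  The divergence is quadratically small near the diagonal, so the two-sided error bound already
  contains the differentiability.
\<close>
lemma tangent_gradient_log_support:
  fixes W :: "(real ^ 'd) set"
  assumes W: "convex W" "compact W" "W \<subseteq> positive_orthant" and L: "0 \<le> L"
    and u: "u \<in> rel_interior prob_simplex" and w: "log_maximizer W u w"
  shows "has_tangent_gradient (log_support L W) u (tangent_part (L *\<^sub>R vec_ln w))"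
    and "tangent_gradient (log_support L W) u = tangent_part (L *\<^sub>R vec_ln w)"
proof -
  have u': "u \<in> prob_simplex" "u \<in> positive_orthant"
    using u rel_interior_prob_simplex_subset by auto
  show *: "has_tangent_gradient (log_support L W) u (tangent_part (L *\<^sub>R vec_ln w))"
  proof (rule has_tangent_gradient_if_quadratic_error[OF tangent_part_mem])
    fix y :: "real ^ 'd" assume y: "y \<in> prob_simplex"
    note b = log_support_error_bounds[OF W L u' w y]
    let ?E = "log_support L W y - log_support L W u - tangent_part (L *\<^sub>R vec_ln w) \<bullet> (y - u)"
    have "?E \<le> L * ((\<Sum>k\<in>UNIV. 1 / u $ k) * (norm (y - u))\<^sup>2)"
      using b(2) mult_left_mono[OF _ L] KL_div_le_quadratic[OF u' y]
      by (fastforce simp: KL_div_positive[OF u'(2)])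
    then show "\<bar>?E\<bar> \<le> L * (\<Sum>k\<in>UNIV. 1 / u $ k) * (norm (y - u))\<^sup>2"
      using b(1) by (simp add: mult.assoc)
  qed
  show "tangent_gradient (log_support L W) u = tangent_part (L *\<^sub>R vec_ln w)"
    by (rule tangent_gradient_eqI[OF u *])
qed

lemma log_support_in_Ent:
  fixes W :: "(real ^ 'd) set"
  assumes W: "convex W" "compact W" "W \<subseteq> positive_orthant" "W \<noteq> {}" and L: "0 \<le> L"
  shows "log_support L W \<in> Ent L"
proof -
  let ?R = "rel_interior prob_simplex :: (real ^ 'd) set"
  define m where "m u = (SOME w. log_maximizer W u w)" for u
  have m: "log_maximizer W u (m u)" for u
    unfolding m_def by (rule someI_ex[OF log_maximizer_exists[OF W(2,4,3)]])
  have R: "u \<in> prob_simplex" "u \<in> positive_orthant" if "u \<in> ?R" for u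
    using that rel_interior_prob_simplex_subset by auto
  note grad = tangent_gradient_log_support[OF W(1-3) L _ m]
  have m_cont: "continuous_on ?R m"
    using continuous_on_log_maximizer[OF W(1,3,2) m rel_interior_prob_simplex_subset] .
  have m_pos: "m u \<in> positive_orthant" for u
    using m[of u] W(3) by (auto simp: log_maximizer_def)
  have ln_cont: "continuous_on ?R (\<lambda>u. vec_ln (m u))"
    unfolding vec_ln_def
    by (intro continuous_intros m_cont ballI positive_orthant_nonzero m_pos)
  have "continuous_on ?R (\<lambda>u. tangent_part (L *\<^sub>R vec_ln (m u)))"
    unfolding tangent_part_def
    using inner_one_one_pos[where 'd = 'd] by (intro continuous_intros ln_cont) auto
  then have "continuous_on ?R (tangent_gradient (log_support L W))"
    using grad(2) by (simp cong: continuous_on_cong)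
  moreover have "log_support L W differentiable (at u within prob_simplex)" if "u \<in> ?R" for u
    using grad(1)[OF that] by (auto simp: has_tangent_gradient_def differentiable_def)
  moreover have "0 \<le> log_support L W y - log_support L W u
          - tangent_gradient (log_support L W) u \<bullet> (y - u)"
      "ereal (log_support L W y - log_support L W u
          - tangent_gradient (log_support L W) u \<bullet> (y - u)) \<le> ereal L * KL_div y u"
    if "y \<in> prob_simplex" "u \<in> ?R" for y u
    using log_support_error_bounds[OF W(1-3) L R[OF that(2)] m that(1)] grad(2)[OF that(2)]
    by simp_all
  ultimately show ?thesis
    using convex_on_log_support[OF W(2,4,3) L convex_prob_simplex] by (simp add: Ent_def)
qed

section \<open>Weights and minimality\<close>

lemma weight_positive: "weight L x f \<xi> i \<in> positive_orthant"
  by (simp add: weight_def vec_exp_def positive_orthant_def)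

lemma scaled_vec_ln_weight:
  assumes "L \<noteq> 0"
  shows "L *\<^sub>R vec_ln (weight L x f \<xi> i) = (f i - \<xi> i \<bullet> x i) *\<^sub>R 1 + \<xi> i"
  using assms by (simp add: weight_def vec_exp_def vec_ln_def vec_eq_iff)

text \<open>A weight encodes the affine function with value \<open>f i\<close> and gradient \<open>\<xi> i\<close> at \<open>x i\<close>.\<close>
lemma inner_vec_ln_weight:
  assumes "L \<noteq> 0" "y \<in> prob_simplex"
  shows "L * (y \<bullet> vec_ln (weight L x f \<xi> i)) = f i + \<xi> i \<bullet> (y - x i)"
proof -
  have "L * (y \<bullet> vec_ln (weight L x f \<xi> i)) = y \<bullet> (L *\<^sub>R vec_ln (weight L x f \<xi> i))"
    by simp
  also have "\<dots> = f i + \<xi> i \<bullet> (y - x i)"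
    using assms by (simp add: scaled_vec_ln_weight inner_add_right inner_diff_right
        prob_simplex_inner_one inner_commute[of _ "\<xi> i"])
  finally show ?thesis .
qed

text \<open>
  Let \<open>\<omega>\<close> be the weight of the tangent of \<open>F\<close> at \<open>u\<close>. If \<open>F\<close> dominates the functional of \<open>w\<close>, then
  relative smoothness gives \<open>y \<bullet> vec_ln (vec_div w \<omega>) \<le> KL_div y u\<close> for all \<open>y\<close>, which the Gibbs
  principle turns into \<open>u \<bullet> vec_div w \<omega> \<le> 1\<close>. This condition, unlike the domination, is linear
  in \<open>w\<close> and thus passes to convex combinations.
\<close>
lemma Ent_minorant_convex_hull_interior:
  fixes F :: "real ^ 'd \<Rightarrow> real"
  assumes L: "0 < L" and F: "F \<in> Ent L" and u: "u \<in> rel_interior prob_simplex"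
    and P: "P \<subseteq> positive_orthant"
    and minor: "\<And>w y. w \<in> P \<Longrightarrow> y \<in> prob_simplex \<Longrightarrow> L * (y \<bullet> vec_ln w) \<le> F y"
    and w: "w \<in> convex hull P"
  shows "L * (u \<bullet> vec_ln w) \<le> F u"
proof -
  have u': "u \<in> prob_simplex" "u \<in> positive_orthant"
    using u rel_interior_prob_simplex_subset by auto
  define \<omega> where "\<omega> = weight L (\<lambda>_. u) (\<lambda>_. F u) (\<lambda>_. tangent_gradient F u) 0"
  have \<omega>: "\<omega> \<in> positive_orthant"
    by (simp add: \<omega>_def weight_positive)
  have \<omega>_inner: "L * (y \<bullet> vec_ln \<omega>) = F u + tangent_gradient F u \<bullet> (y - u)"
    if "y \<in> prob_simplex" for y
    using L that by (simp add: \<omega>_def inner_vec_ln_weight)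
  have "u \<bullet> vec_div p \<omega> \<le> 1" if p: "p \<in> P" for p
  proof -
    have pp: "p \<in> positive_orthant"
      using p P by blast
    have "ereal (y \<bullet> vec_ln (vec_div p \<omega>)) \<le> KL_div y u" if y: "y \<in> prob_simplex" for y
    proof -
      have "ereal (F y - F u - tangent_gradient F u \<bullet> (y - u)) \<le> ereal L * KL_div y u"
        using F y u by (simp add: Ent_def)
      then have "L * (y \<bullet> vec_ln (vec_div p \<omega>)) \<le> L * (\<Sum>k\<in>UNIV. y $ k * ln (y $ k / u $ k))"
        using minor[OF p y] \<omega>_inner[OF y]
        by (simp add: KL_div_positive[OF u'(2)] vec_ln_vec_div pp \<omega> inner_diff_right right_diff_distrib)
      then show ?thesis
        using L by (simp add: KL_div_positive[OF u'(2)])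
    qed
    then show ?thesis
      using inner_le_one_iff_inner_vec_ln_le_KL_div[OF u'(2) vec_div_positive[OF pp \<omega>]] by blast
  qed
  then have "convex hull P \<subseteq> {w. u \<bullet> vec_div w \<omega> \<le> 1}"
    by (intro hull_minimal convex_inner_vec_div_le) auto
  then have "u \<bullet> vec_div w \<omega> \<le> 1"
    using w by blast
  moreover have "w \<in> positive_orthant"
    using hull_minimal[of P _ convex, OF P convex_positive_orthant] w by blast
  ultimately have "u \<bullet> vec_ln w \<le> u \<bullet> vec_ln \<omega>"
    using inner_vec_ln_le_if_inner_vec_div_le_one[OF u'(1) \<omega>] by blast
  then have "L * (u \<bullet> vec_ln w) \<le> L * (u \<bullet> vec_ln \<omega>)"
    using L by simp
  then show ?thesis
    using \<omega>_inner[OF u'(1)] by simp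
qed

text \<open>
  A convex function can only jump upwards at the boundary: along the segment from \<open>y\<close> to an
  interior point \<open>c\<close> it lies below its chord, so \<open>F y\<close> is at least the limit of its values there.
\<close>
lemma linear_minorant_from_rel_interior:
  fixes F :: "'a::euclidean_space \<Rightarrow> real"
  assumes F: "convex_on S F" and c: "c \<in> rel_interior S" and y: "y \<in> S"
    and minor: "\<And>u. u \<in> rel_interior S \<Longrightarrow> u \<bullet> a \<le> F u"
  shows "y \<bullet> a \<le> F y"
proof (rule ccontr)
  assume "\<not> ?thesis"
  then have gap: "0 < y \<bullet> a - F y"
    by simp
  have S: "convex S"
    using F by (simp add: convex_on_def)
  have le: "(1 - t) * (y \<bullet> a - F y) \<le> t * (F c - c \<bullet> a)" if t: "0 < t" "t \<le> 1" for t
  proof -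
    have "y - t *\<^sub>R (y - c) \<in> rel_interior S"
      using rel_interior_convex_shrink[OF S c y t] .
    then have ri: "(1 - t) *\<^sub>R y + t *\<^sub>R c \<in> rel_interior S"
      by (simp add: algebra_simps)
    have "c \<in> S"
      using c rel_interior_subset by blast
    then have "F ((1 - t) *\<^sub>R y + t *\<^sub>R c) \<le> (1 - t) * F y + t * F c"
      using F y t by (simp add: convex_on_def)
    then show ?thesis
      using minor[OF ri] by (simp add: inner_add_left algebra_simps)
  qed
  \<comment> \<open>Near \<open>y\<close>, that is for small \<open>t\<close>, the gap outweighs the contribution of \<open>c\<close>.\<close>
  define K where "K = \<bar>F c - c \<bullet> a\<bar> + (y \<bullet> a - F y)"
  define t where "t = (y \<bullet> a - F y) / (2 * K)"
  have K: "0 < K" "y \<bullet> a - F y \<le> K"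
    using gap by (auto simp: K_def)
  then have t: "0 < t" "t \<le> 1 / 2"
    using gap by (auto simp: t_def field_simps)
  have "(y \<bullet> a - F y) = t * (2 * K)"
    using K by (simp add: t_def)
  also have "t * (2 * K) = 2 * (t * \<bar>F c - c \<bullet> a\<bar>) + 2 * (t * (y \<bullet> a - F y))"
    by (simp add: K_def algebra_simps)
  finally have "(1 - t) * (y \<bullet> a - F y) = 2 * (t * \<bar>F c - c \<bullet> a\<bar>) + t * (y \<bullet> a - F y)"
    by (simp add: algebra_simps)
  moreover have "t * (F c - c \<bullet> a) \<le> t * \<bar>F c - c \<bullet> a\<bar>"
    using t by (intro mult_left_mono) auto
  moreover have "0 < t * (y \<bullet> a - F y)" "0 \<le> t * \<bar>F c - c \<bullet> a\<bar>"
    using t gap by auto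
  ultimately show False
    using le[of t] t by linarith
qed

theorem proposition13:
  fixes L :: real and N :: nat
    and x :: "nat \<Rightarrow> real ^ 'd" and f :: "nat \<Rightarrow> real" and \<xi> :: "nat \<Rightarrow> real ^ 'd"
  assumes "L > 0" and "N \<ge> 1"
    and "\<And>i. i \<in> {1..N} \<Longrightarrow> x i \<in> rel_interior prob_simplex"
    and "\<And>i. i \<in> {1..N} \<Longrightarrow> \<xi> i \<in> tangent_space"
    and "\<And>i j. i \<in> {1..N} \<Longrightarrow> j \<in> {1..N} \<Longrightarrow>
           x i \<bullet> vec_div (weight L x f \<xi> j) (weight L x f \<xi> i) \<le> 1"
  shows "(\<forall>y \<in> prob_simplex. \<exists>w \<in> weight_hull L N x f \<xi>.
            \<forall>v \<in> weight_hull L N x f \<xi>. y \<bullet> vec_ln v \<le> y \<bullet> vec_ln w) \<and>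
         min_interpolant L N x f \<xi> \<in> Ent L \<and>
         interpolates N x f \<xi> (min_interpolant L N x f \<xi>) \<and>
         (\<forall>F \<in> Ent L. interpolates N x f \<xi> F \<longrightarrow>
            (\<forall>y \<in> prob_simplex. min_interpolant L N x f \<xi> y \<le> F y))"
proof -
  let ?w = "weight L x f \<xi>"
  let ?P = "?w ` {1..N}"
  define W where "W = weight_hull L N x f \<xi>"
  have W_hull: "W = convex hull ?P"
    by (simp add: W_def weight_hull_def)
  have P: "?P \<subseteq> positive_orthant"
    using weight_positive by blast
  have W: "convex W" "compact W" "W \<subseteq> positive_orthant" "W \<noteq> {}"
    using assms(2) hull_minimal[of ?P _ convex, OF P convex_positive_orthant]
    by (simp_all add: W_hull finite_imp_compact_convex_hull)
  have L0: "0 \<le> L" "L \<noteq> 0"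
    using assms(1) by auto
  have f_eq: "min_interpolant L N x f \<xi> = log_support L W"
    by (rule ext) (simp add: min_interpolant_def log_support_def W_def)
  have x: "x i \<in> prob_simplex" if "i \<in> {1..N}" for i
    using assms(3)[OF that] rel_interior_prob_simplex_subset by blast

  have max: "log_maximizer W (x i) (?w i)" if i: "i \<in> {1..N}" for i
  proof -
    have "W \<subseteq> {w. x i \<bullet> vec_div w (?w i) \<le> 1}"
      unfolding W_hull using assms(5)[OF i]
      by (intro hull_minimal convex_inner_vec_div_le) auto
    moreover have "?w i \<in> W"
      unfolding W_hull using i by (intro hull_inc) blast
    ultimately show ?thesis
      using inner_vec_ln_le_if_inner_vec_div_le_one[OF x[OF i] weight_positive] W(3)
      by (fastforce simp: log_maximizer_def)
  qed
  have interp: "interpolates N x f \<xi> (log_support L W)"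
    unfolding interpolates_def
  proof (intro ballI conjI)
    fix i assume i: "i \<in> {1..N}"
    show "log_support L W (x i) = f i"
      using inner_vec_ln_weight[OF L0(2) x[OF i], of x f \<xi> i] by (simp add: log_support_eq[OF max[OF i]])
    show "tangent_gradient (log_support L W) (x i) = \<xi> i"
      using tangent_gradient_log_support(2)[OF W(1-3) L0(1) assms(3)[OF i] max[OF i]] assms(4)[OF i]
      by (simp add: scaled_vec_ln_weight[OF L0(2)] tangent_part_shift)
  qed
  have minimal: "log_support L W y \<le> F y"
    if F: "F \<in> Ent L" and int: "interpolates N x f \<xi> F" and y: "y \<in> prob_simplex" for F y
  proof -
    obtain w where w: "log_maximizer W y w"
      using log_maximizer_exists[OF W(2,4,3)] by blast
    have minor: "L * (z \<bullet> vec_ln p) \<le> F z" if p: "p \<in> ?P" and z: "z \<in> prob_simplex" for p z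
    proof -
      obtain i where i: "i \<in> {1..N}" "p = ?w i"
        using p by blast
      have "0 \<le> F z - F (x i) - tangent_gradient F (x i) \<bullet> (z - x i)"
        using F z assms(3)[OF i(1)] by (simp add: Ent_def)
      then show ?thesis
        using int i by (simp add: interpolates_def inner_vec_ln_weight[OF L0(2) z])
    qed
    have "u \<bullet> (L *\<^sub>R vec_ln w) \<le> F u" if "u \<in> rel_interior prob_simplex" for u
      using Ent_minorant_convex_hull_interior[OF assms(1) F that P minor] w
      by (simp add: log_maximizer_def W_hull)
    moreover have "convex_on prob_simplex F"
      using F by (simp add: Ent_def)
    ultimately have "y \<bullet> (L *\<^sub>R vec_ln w) \<le> F y"
      using linear_minorant_from_rel_interior[OF _ assms(3)[of 1] y, of F "L *\<^sub>R vec_ln w"] assms(2)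
      by simp
    then show ?thesis
      by (simp add: log_support_eq[OF w])
  qed
  have attained: "\<exists>w\<in>W. \<forall>v\<in>W. y \<bullet> vec_ln v \<le> y \<bullet> vec_ln w" for y
    using log_maximizer_exists[OF W(2,4,3), of y] by (auto simp: log_maximizer_def)
  show ?thesis
    unfolding f_eq W_def[symmetric]
    using attained log_support_in_Ent[OF W L0(1)] interp minimal by blast
qed

end
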